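(* Let $u\in[2]^n$ be a word of length $n$ over $\{1,2\}$ with $1\le m_1(u)<m_2(u)$. Then for a word $w$ over the positive integers, $w\in C(u)$ if and only if both of the following hold: (a) $c_1(w)=c_1(u)\le c_2(w)$, or $c_1(w)=c_2(w)<c_1(u)$; (b) $\max R_i(w)\le 2$ for $i\le 2$.
   Context: Juxtaposition denotes concatenation of words. $P(w)$ is the insertion tableau of $w$ under the Robinson–Schensted–Knuth (row-insertion) correspondence, and $C(u)=\{w : P(uw)=P(wu)\}$. $R_i(w)$ denotes the $i$th row of $P(w)$ (empty if $P(w)$ has fewer than $i$ rows; the condition $\max R_i(w)\le2$ holds vacuously for an empty row). $m_a(u)$ is the number of occurrences of the letter $a$ in $u$. For a positive integer $a$, $c_a(w)$ is the number of singleton $a$-columns of $P(w)$, i.e. columns of $P(w)$ of length exactly one whose sole entry is $a$. *)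

theory Defs
  imports Main
begin

text \<open>
  Words over the positive integers are lists of nonzero natural numbers. A tableau is the list of
  its nonempty rows, in English notation: the row that receives the inserted letters comes first.
\<close>

definition pos_words :: "nat list set" where
  "pos_words = lists {1..}"

text \<open>
  A letter \<open>x\<close> replaces the leftmost entry of the row strictly greater than \<open>x\<close>, and that entry
  is the bumped letter; without such an entry, \<open>x\<close> goes to the end and nothing is bumped.
\<close>

fun row_insert :: "nat \<Rightarrow> nat list \<Rightarrow> nat list \<times> nat option" where
  "row_insert x [] = ([x], None)"
| "row_insert x (y # ys) =
    (if x < y then (x # ys, Some y)
     else (case row_insert x ys of (r, b) \<Rightarrow> (y # r, b)))"

fun tableau_insert :: "nat \<Rightarrow> nat list list \<Rightarrow> nat list list" where
  "tableau_insert x [] = [[x]]"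
| "tableau_insert x (r # rs) =
    (case row_insert x r of
       (r', None) \<Rightarrow> r' # rs
     | (r', Some y) \<Rightarrow> r' # tableau_insert y rs)"

definition insertion_tableau :: "nat list \<Rightarrow> nat list list" where
  "insertion_tableau w = fold tableau_insert w []"

text \<open>Rows are numbered from 1.\<close>

definition tableau_row :: "nat \<Rightarrow> nat list \<Rightarrow> nat list" where
  "tableau_row i w =
    (if 1 \<le> i \<and> i \<le> length (insertion_tableau w) then insertion_tableau w ! (i - 1) else [])"

definition commuting_words :: "nat list \<Rightarrow> nat list set" where
  "commuting_words u =
    {w \<in> pos_words. insertion_tableau (u @ w) = insertion_tableau (w @ u)}"

text \<open>The lists in \<^term>\<open>transpose (insertion_tableau w)\<close> are the
  columns of the tableau, each read from its top entry (first row) downwards.\<close>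

definition singleton_columns :: "nat \<Rightarrow> nat list \<Rightarrow> nat" where
  "singleton_columns a w = count_list (transpose (insertion_tableau w)) [a]"

end

theory Submission
  imports Defs "HOL-Library.Multiset"
begin

text \<open>
  \<open>P(uw) = P(wu)\<close> holds exactly if \<open>uw\<close> and \<open>wu\<close> are Knuth equivalent, so \<open>u\<close> and \<open>w\<close> may be
  replaced by the reading words of their tableaux; for \<open>u\<close> this is \<open>2\<^sup>r 1\<^sup>p 2\<^sup>q\<close>. If rows 1 and 2 of
  \<open>P(w)\<close> only contain the letters 1 and 2, then \<open>w\<close> is equivalent to \<open>X 2\<^sup>j 1\<^sup>i 2\<^sup>l\<close>, where \<open>X\<close> reads
  the lower rows. Inserting the pieces one after the other shows that in both \<open>P(uw)\<close> and \<open>P(wu)\<close>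
  these lower rows stay as they are, below the tableau of a two-letter word. The tableaux agree if
  and only if their second rows have the same length, which is
  \<open>min q (i - j) = min l (p - r)\<close>; since \<open>p - r < q\<close>, this is condition (a).

  Conversely, if \<open>w\<close> commutes with \<open>u\<close>, then it commutes with all powers \<open>u\<^sup>k\<close>. The second row
  of \<open>P(u\<^sup>k)\<close> becomes arbitrarily long, so appending \<open>u\<^sup>k\<close> to \<open>w\<close> bumps all letters above 2 out of
  rows 1 and 2. In \<open>P(u\<^sup>k w)\<close>, however, a letter above 2 from one of the first two rows of \<open>P(w)\<close>
  would remain in one of these rows.
\<close>

section \<open>Insertion of words, one row at a time\<close>

lemma row_insert_Cons:
  "fst (row_insert x (y # ys)) = (if x < y then x # ys else y # fst (row_insert x ys))"
  "snd (row_insert x (y # ys)) = (if x < y then Some y else snd (row_insert x ys))"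
  by (auto split: prod.splits)

declare row_insert.simps(2) [simp del]
declare row_insert_Cons [simp]

fun opt_word :: "nat option \<Rightarrow> nat list" where
  "opt_word None = []"
| "opt_word (Some y) = [y]"

primrec row_after :: "nat list \<Rightarrow> nat list \<Rightarrow> nat list" where
  "row_after [] r = r"
| "row_after (x # w) r = row_after w (fst (row_insert x r))"

text \<open>The bumped letters, in their order, are the word that the next row receives; this turns
  the computation of a tableau into a recursion over its rows.\<close>

primrec bumped :: "nat list \<Rightarrow> nat list \<Rightarrow> nat list" where
  "bumped [] r = []"
| "bumped (x # w) r = opt_word (snd (row_insert x r)) @ bumped w (fst (row_insert x r))"

lemma row_after_append: "row_after (v @ w) r = row_after w (row_after v r)"
  by (induction v arbitrary: r) auto

lemma bumped_append: "bumped (v @ w) r = bumped v r @ bumped w (row_after v r)"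
  by (induction v arbitrary: r) auto

abbreviation first_row :: "nat list \<Rightarrow> nat list" where
  "first_row w \<equiv> row_after w []"

abbreviation rest_word :: "nat list \<Rightarrow> nat list" where
  "rest_word w \<equiv> bumped w []"

lemma row_insert_nonempty [simp]: "fst (row_insert x r) \<noteq> []"
  by (cases r) auto

lemma row_after_eq_Nil_iff [simp]: "row_after w r = [] \<longleftrightarrow> w = [] \<and> r = []"
  by (induction w arbitrary: r) auto

lemma mset_row_insert:
  "mset (fst (row_insert x r)) + mset (opt_word (snd (row_insert x r))) = add_mset x (mset r)"
  by (induction r) (auto simp: add_mset_commute)

lemma mset_row_after: "mset (row_after w r) + mset (bumped w r) = mset w + mset r"
proof (induction w arbitrary: r)
  case (Cons x w)
  have "mset (row_after (x # w) r) + mset (bumped (x # w) r)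
      = (mset (row_after w (fst (row_insert x r))) + mset (bumped w (fst (row_insert x r))))
        + mset (opt_word (snd (row_insert x r)))"
    by (simp add: ac_simps)
  also have "\<dots> = mset w + add_mset x (mset r)"
    unfolding Cons.IH mset_row_insert [symmetric] by (simp add: ac_simps)
  finally show ?case by simp
qed simp

lemma set_row_after: "set (row_after w r) \<union> set (bumped w r) = set w \<union> set r"
  using arg_cong [OF mset_row_after [of w r], of set_mset] by simp

lemma length_row_after: "length (row_after w r) + length (bumped w r) = length w + length r"
  using arg_cong [OF mset_row_after [of w r], of size] by simp

lemma length_rest_word_less: "w \<noteq> [] \<Longrightarrow> length (rest_word w) < length w"
  using length_row_after [of w "[]"] row_after_eq_Nil_iff [of w "[]"]
  by (metis add.commute add_cancel_right_right length_0_conv less_add_same_cancel1 list.size(3) length_greater_0_conv)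

lemma set_row_insert_subset: "set (fst (row_insert x r)) \<subseteq> insert x (set r)"
  by (induction r) auto

lemma sorted_row_insert: "sorted r \<Longrightarrow> sorted (fst (row_insert x r))"
proof (induction r)
  case (Cons h t)
  then show ?case
    using set_row_insert_subset [of x t] by fastforce
qed simp

lemma sorted_row_after: "sorted r \<Longrightarrow> sorted (row_after w r)"
  by (induction w arbitrary: r) (auto intro: sorted_row_insert)

lemma sorted_first_row: "sorted (first_row w)"
  by (simp add: sorted_row_after)

lemma fold_tableau_insert_Cons:
  "fold tableau_insert w (r # rs) = row_after w r # fold tableau_insert (bumped w r) rs"
proof (induction w arbitrary: r rs)
  case (Cons x w)
  then show ?case by (cases "row_insert x r"; cases "snd (row_insert x r)") auto
qed simp

lemma insertion_tableau_Nil [simp]: "insertion_tableau [] = []"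
  by (simp add: insertion_tableau_def)

lemma insertion_tableau_rec:
  "w \<noteq> [] \<Longrightarrow> insertion_tableau w = first_row w # insertion_tableau (rest_word w)"
  by (cases w) (simp_all add: insertion_tableau_def fold_tableau_insert_Cons)

text \<open>No case for empty words is needed in the statement, because only the empty word has an
  empty first row.\<close>

lemma insertion_tableau_eq_iff:
  "insertion_tableau v = insertion_tableau w \<longleftrightarrow>
   first_row v = first_row w \<and> insertion_tableau (rest_word v) = insertion_tableau (rest_word w)"
  by (cases "v = []"; cases "w = []")
     (simp_all add: insertion_tableau_rec, metis row_after_eq_Nil_iff)

section \<open>Knuth equivalence leaves the tableau unchanged\<close>

inductive knuth :: "nat list \<Rightarrow> nat list \<Rightarrow> bool" (infix "\<approx>" 50) where
  knuth_refl [simp]: "w \<approx> w"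
| knuth_sym: "v \<approx> w \<Longrightarrow> w \<approx> v"
| knuth_trans [trans]: "u \<approx> v \<Longrightarrow> v \<approx> w \<Longrightarrow> u \<approx> w"
| knuth1: "x < y \<Longrightarrow> y \<le> z \<Longrightarrow> p @ [y, z, x] @ q \<approx> p @ [y, x, z] @ q"
| knuth2: "x \<le> y \<Longrightarrow> y < z \<Longrightarrow> p @ [x, z, y] @ q \<approx> p @ [z, x, y] @ q"

lemma knuth_context: "v \<approx> w \<Longrightarrow> p @ v @ q \<approx> p @ w @ q"
proof (induction rule: knuth.induct)
  case (knuth1 x y z p' q')
  then show ?case using knuth.knuth1 [of x y z "p @ p'" "q' @ q"] by simp
next
  case (knuth2 x y z p' q')
  then show ?case using knuth.knuth2 [of x y z "p @ p'" "q' @ q"] by simp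
qed (auto intro: knuth_sym knuth_trans)

lemma knuth_append: "v \<approx> v' \<Longrightarrow> w \<approx> w' \<Longrightarrow> v @ w \<approx> v' @ w'"
  using knuth_context [of v v' "[]" w] knuth_context [of w w' v' "[]"]
  by (auto intro: knuth_trans)

lemma bump_greater: "snd (row_insert x r) = Some y \<Longrightarrow> x < y \<and> y \<in> set r"
  by (induction r) (auto split: if_splits)

text \<open>Row bumping: after \<open>x\<close>, a letter \<open>x' >= x\<close> lands strictly to
  the right of \<open>x\<close>, so if it still finds a letter to bump, then so did
  \<open>x\<close>, further to the left.\<close>

lemma bump_mono:
  assumes "x \<le> x'" "sorted r" "snd (row_insert x' (fst (row_insert x r))) = Some y'"
  shows "\<exists>y. snd (row_insert x r) = Some y \<and> y \<le> y'"
  using assms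
proof (induction r)
  case (Cons h t)
  then show ?case
    by (auto split: if_splits dest: bump_greater)
qed auto

text \<open>The row now contains \<open>x\<close>, so the leftmost entry above \<open>x'\<close> is
  \<open>x\<close> itself or stands to its left.\<close>

lemma bump_antimono:
  assumes "x' < x" "sorted r"
  shows "\<exists>y'. snd (row_insert x' (fst (row_insert x r))) = Some y' \<and> y' \<le> x"
  using assms by (induction r) (auto split: if_splits)

text \<open>Induction on the row: if \<open>h <= x\<close>, all three letters pass the head;
  otherwise \<open>h\<close> is bumped, and the two bumped words are equal or again differ by an
  elementary Knuth relation.\<close>

lemma knuth1_row:
  assumes "x < y" "y \<le> z" "sorted r"
  shows "row_after [y, z, x] r = row_after [y, x, z] r \<and> bumped [y, z, x] r \<approx> bumped [y, x, z] r"
  using assms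
proof (induction r)
  case Nil
  then show ?case by auto
next
  case (Cons h t)
  then have t: "sorted t" "\<forall>k\<in>set t. h \<le> k" by auto
  consider "h \<le> x" | "x < h" "h \<le> y" | "y < h" by linarith
  then show ?case
  proof cases
    case 1
    with Cons.IH Cons.prems show ?thesis by auto
  next
    case 2
    let ?b = "snd (row_insert y t)" and ?c = "snd (row_insert z (fst (row_insert y t)))"
    have "opt_word ?b @ opt_word ?c @ [h] \<approx> opt_word ?b @ [h] @ opt_word ?c"
    proof (cases ?c)
      case (Some c)
      then obtain b where "?b = Some b" "b \<le> c" using bump_mono [of y z t c] Cons.prems t by auto
      moreover have "h < b" using bump_greater [of y t b] \<open>?b = Some b\<close> 2 by auto
      ultimately show ?thesis using Some knuth1 [of h b c "[]" "[]"] by simp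
    qed simp
    with 2 Cons.prems show ?thesis by auto
  next
    case 3
    let ?c = "snd (row_insert z t)"
    have "[h] @ opt_word ?c @ [y] \<approx> [h] @ [y] @ opt_word ?c"
    proof (cases ?c)
      case (Some c)
      then have "h \<le> c" using bump_greater t by blast
      then show ?thesis using Some 3 knuth1 [of y h c "[]" "[]"] by simp
    qed simp
    with 3 Cons.prems show ?thesis by auto
  qed
qed

lemma knuth2_row:
  assumes "x \<le> y" "y < z" "sorted r"
  shows "row_after [x, z, y] r = row_after [z, x, y] r \<and> bumped [x, z, y] r \<approx> bumped [z, x, y] r"
  using assms
proof (induction r)
  case Nil
  then show ?case by auto
next
  case (Cons h t)
  then have t: "sorted t" "\<forall>k\<in>set t. h \<le> k" by auto
  consider "h \<le> x" | "x < h" "z < h" | "x < h" "h \<le> z" by linarith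
  then show ?case
  proof cases
    case 1
    with Cons.IH Cons.prems show ?thesis by auto
  next
    case 2
    show ?thesis
    proof (cases t)
      case Nil
      with 2 Cons.prems show ?thesis by auto
    next
      case (Cons k t')
      then have "h \<le> k" using t by auto
      then have "[h, k, z] \<approx> [h, z, k]" using 2 knuth1 [of z h k "[]" "[]"] by simp
      with Cons 2 \<open>h \<le> k\<close> Cons.prems show ?thesis by auto
    qed
  next
    case 3
    let ?b = "snd (row_insert z t)" and ?c = "snd (row_insert y (fst (row_insert z t)))"
    \<comment> \<open>If \<open>z\<close> bumps a letter \<open>b\<close>, then
      \<open>h <= c <= z < b\<close>, so the bumped words \<open>h b c\<close> and
      \<open>b h c\<close> are related by \<open>knuth2\<close>.\<close>
    obtain c where c: "?c = Some c" "c \<le> z" using bump_antimono [of y z t] Cons.prems t by auto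
    have "c \<in> insert z (set t)"
      using bump_greater [OF c(1)] set_row_insert_subset [of z t] by auto
    then have "h \<le> c" using t 3 by auto
    have "[h] @ opt_word ?b @ opt_word ?c \<approx> opt_word ?b @ [h] @ opt_word ?c"
    proof (cases ?b)
      case (Some b)
      then have "z < b" using bump_greater by blast
      then show ?thesis using Some c \<open>h \<le> c\<close> knuth2 [of h c b "[]" "[]"] by simp
    qed simp
    with 3 Cons.prems show ?thesis by auto
  qed
qed

lemma knuth_row:
  assumes "v \<approx> w" "sorted r"
  shows "row_after v r = row_after w r \<and> bumped v r \<approx> bumped w r"
  using assms
proof (induction rule: knuth.induct)
  case (knuth1 x y z p q)
  with knuth1_row [OF knuth1(1,2) sorted_row_after [OF \<open>sorted r\<close>, of p]] show ?case
    unfolding row_after_append bumped_append by (auto intro!: knuth_append simp del: bumped.simps row_after.simps)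
next
  case (knuth2 x y z p q)
  with knuth2_row [OF knuth2(1,2) sorted_row_after [OF \<open>sorted r\<close>, of p]] show ?case
    unfolding row_after_append bumped_append by (auto intro!: knuth_append simp del: bumped.simps row_after.simps)
qed (auto intro: knuth_sym knuth_trans)

lemma knuth_insertion_tableau: "v \<approx> w \<Longrightarrow> insertion_tableau v = insertion_tableau w"
proof (induction "length v" arbitrary: v w rule: less_induct)
  case less
  have *: "first_row v = first_row w" "rest_word v \<approx> rest_word w"
    using knuth_row [OF less.prems] by auto
  show ?case
  proof (cases "v = []")
    case True
    then show ?thesis using * row_after_eq_Nil_iff [of w "[]"] by simp
  next
    case False
    with less.hyps [OF length_rest_word_less *(2)] * show ?thesis
      by (subst insertion_tableau_eq_iff) simp
  qed
qed

section \<open>Every word is Knuth equivalent to the reading word of its tableau\<close>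

lemma knuth_move_left: "sorted (h # t) \<Longrightarrow> x < h \<Longrightarrow> h # t @ [x] \<approx> h # x # t"
proof (induction t arbitrary: h)
  case (Cons k t)
  have "[h] @ k # t @ [x] \<approx> [h] @ k # x # t" using Cons by (intro knuth_append) auto
  also have "[h] @ k # x # t \<approx> h # x # k # t" using knuth1 [of x h k "[]" t] Cons.prems by auto
  finally show ?case by simp
qed simp

text \<open>One insertion step is a chain of Knuth moves: \<open>x\<close> travels left to its
  place, and the bumped letter travels on to the front of the row.\<close>

lemma knuth_row_insert:
  "sorted r \<Longrightarrow> r @ [x] \<approx> opt_word (snd (row_insert x r)) @ fst (row_insert x r)"
proof (induction r)
  case (Cons h t)
  show ?case
  proof (cases "x < h")
    case True
    then show ?thesis using knuth_move_left [of h t x] Cons.prems by simp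
  next
    case False
    let ?t = "fst (row_insert x t)"
    have 1: "[h] @ t @ [x] \<approx> [h] @ opt_word (snd (row_insert x t)) @ ?t"
      using knuth_append [OF knuth_refl [of "[h]"] Cons.IH] Cons.prems by simp
    show ?thesis
    proof (cases "snd (row_insert x t)")
      case None
      with 1 False show ?thesis by simp
    next
      case (Some y)
      \<comment> \<open>Moving \<open>y\<close> in front of \<open>h\<close> by
        \<open>knuth2\<close> takes a letter \<open>k\<close> behind it with
        \<open>h <= k < y\<close>; the head of the new row qualifies, since it is at most
        \<open>x\<close>.\<close>
      obtain k t' where t': "?t = k # t'" by (cases ?t) auto
      then have "k \<le> x" by (cases t) (auto split: if_splits)
      moreover have "h \<le> k"
        using Cons.prems False set_row_insert_subset [of x t] t' by auto
      moreover have "x < y" using Some bump_greater by blast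
      ultimately have "h # y # ?t \<approx> y # h # ?t" using t' knuth2 [of h k y "[]" t'] by simp
      with 1 Some False show ?thesis by (auto intro: knuth_trans)
    qed
  qed
qed simp

lemma knuth_row_after: "sorted r \<Longrightarrow> r @ w \<approx> bumped w r @ row_after w r"
proof (induction w arbitrary: r)
  case (Cons x w)
  let ?r = "fst (row_insert x r)" and ?y = "opt_word (snd (row_insert x r))"
  have "r @ x # w = (r @ [x]) @ w" by simp
  also have "\<dots> \<approx> (?y @ ?r) @ w" by (intro knuth_append knuth_row_insert Cons.prems knuth_refl)
  also have "(?y @ ?r) @ w = ?y @ (?r @ w)" by simp
  also have "\<dots> \<approx> ?y @ (bumped w ?r @ row_after w ?r)"
    by (intro knuth_append Cons.IH sorted_row_insert Cons.prems knuth_refl)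
  finally show ?case by simp
qed simp

lemma knuth_first_row: "w \<approx> rest_word w @ first_row w"
  using knuth_row_after [of "[]" w] by simp

lemma knuth_reading: "insertion_tableau v = insertion_tableau w \<Longrightarrow> v \<approx> w"
proof (induction "length v" arbitrary: v w rule: less_induct)
  case less
  have rows: "first_row v = first_row w"
    and rest: "insertion_tableau (rest_word v) = insertion_tableau (rest_word w)"
    using iffD1 [OF insertion_tableau_eq_iff less.prems] by simp_all
  show ?case
  proof (cases "v = []")
    case True
    then show ?thesis using rows row_after_eq_Nil_iff [of w "[]"] by simp
  next
    case False
    note knuth_first_row [of v]
    also have "rest_word v @ first_row v \<approx> rest_word w @ first_row w"
      using less.hyps [OF length_rest_word_less rest] False rows by (auto intro: knuth_append)
    also note knuth_sym [OF knuth_first_row]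
    finally show ?thesis .
  qed
qed

lemma insertion_tableau_eq_iff_knuth: "insertion_tableau v = insertion_tableau w \<longleftrightarrow> v \<approx> w"
  using knuth_reading knuth_insertion_tableau by blast

section \<open>Column strictness and the insertion of whole rows\<close>

fun below :: "nat list \<Rightarrow> nat list \<Rightarrow> bool" where
  "below [] r \<longleftrightarrow> True"
| "below (y # s) [] \<longleftrightarrow> False"
| "below (y # s) (x # r) \<longleftrightarrow> x < y \<and> below s r"

lemma below_length: "below s r \<Longrightarrow> length s \<le> length r"
  by (induction s r rule: below.induct) auto

lemma below_replicate: "below s (replicate c k) \<longleftrightarrow> length s \<le> c \<and> (\<forall>x\<in>set s. k < x)"
proof (induction s arbitrary: c)
  case (Cons x s)
  then show ?case by (cases c) auto
qed simp

lemma below_row_insert: "below s r \<Longrightarrow> below s (fst (row_insert x r))"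
  by (induction s r rule: below.induct) (auto simp del: One_nat_def)

text \<open>The bumped letter lands in \<open>s\<close> weakly to the left of the column it came
  from, hence under an entry that is at most \<open>x\<close> and so smaller than
  \<open>y\<close>.\<close>

lemma below_bump:
  assumes "sorted r" "sorted s" "below s r" "snd (row_insert x r) = Some y"
  shows "below (fst (row_insert y s)) (fst (row_insert x r))"
  using assms
proof (induction s r rule: below.induct)
  case (1 r)
  then show ?case
    by (cases r) (auto split: if_splits dest: bump_greater)
next
  case (3 z s h t)
  then show ?case
    by (auto split: if_splits dest: bump_greater intro: below_row_insert)
qed auto

lemma below_row_after:
  "sorted r \<Longrightarrow> sorted s \<Longrightarrow> below s r \<Longrightarrow> below (row_after (bumped w r) s) (row_after w r)"
proof (induction w arbitrary: r s)
  case (Cons x w)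
  let ?y = "snd (row_insert x r)"
  have "below (row_after (opt_word ?y) s) (fst (row_insert x r))"
    using Cons.prems by (cases ?y) (auto intro: below_row_insert below_bump)
  then show ?case
    using Cons by (auto simp: row_after_append intro!: Cons.IH sorted_row_insert sorted_row_after)
qed simp

lemma below_first_row: "below (first_row (rest_word w)) (first_row w)"
  by (rule below_row_after) auto

lemma row_insert_prefix:
  "\<forall>a\<in>set A. a \<le> x \<Longrightarrow>
    fst (row_insert x (A @ t)) = A @ fst (row_insert x t) \<and>
    snd (row_insert x (A @ t)) = snd (row_insert x t)"
  by (induction A) auto

lemma row_after_prefix:
  "\<forall>a\<in>set A. \<forall>x\<in>set w. a \<le> x \<Longrightarrow>
    row_after w (A @ t) = A @ row_after w t \<and> bumped w (A @ t) = bumped w t"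
  by (induction w arbitrary: t) (auto simp: row_insert_prefix)

text \<open>Each letter of \<open>s\<close> bumps the letter of \<open>t\<close> in its own column,
  from left to right; the letters of \<open>s\<close> beyond the end of \<open>t\<close> are
  appended. In the induction, the letters already placed join the prefix \<open>A\<close>.\<close>

lemma row_after_slide:
  assumes "below t s" "sorted s" "\<forall>a\<in>set A. \<forall>x\<in>set s. a \<le> x"
  shows "row_after s (A @ t) = A @ s \<and> bumped s (A @ t) = t"
  using assms
proof (induction s arbitrary: A t)
  case Nil
  then show ?case by (cases t) auto
next
  case (Cons x s)
  show ?case
  proof (cases t)
    case Nil
    then show ?thesis
      using Cons.IH [of "[]" "A @ [x]"] Cons.prems row_insert_prefix [of A x "[]"] by auto
  next
    case (Cons k t')
    then show ?thesis
      using Cons.IH [of t' "A @ [x]"] Cons.prems row_insert_prefix [of A x "k # t'"] by auto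
  qed
qed

lemma bumped_greater: "y \<in> set (bumped w r) \<Longrightarrow> \<exists>x\<in>set w. x < y"
proof (induction w arbitrary: r)
  case (Cons x w)
  then show ?case
    by (cases "snd (row_insert x r)") (auto dest: bump_greater)
qed simp

section \<open>Words and rows over the letters 1 and 2\<close>

abbreviation two :: "nat \<Rightarrow> nat \<Rightarrow> nat list" where
  "two i l \<equiv> replicate i 1 @ replicate l 2"

lemma two_insert_2:
  "row_after (replicate m 2) (two i l) = two i (l + m)" "bumped (replicate m 2) (two i l) = []"
proof -
  have "\<forall>a\<in>set (two i l). \<forall>x\<in>set (replicate m 2). a \<le> x" by auto
  from row_after_slide [of "[]" "replicate m 2", OF _ _ this]
  show "row_after (replicate m 2) (two i l) = two i (l + m)" "bumped (replicate m 2) (two i l) = []"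
    by (simp_all add: replicate_add)
qed

lemma two_insert_1:
  "row_after (replicate m 1) (two i l) = two (i + m) (l - m) \<and>
   bumped (replicate m 1) (two i l) = replicate (min m l) 2"
proof (induction m arbitrary: i l)
  case (Suc m)
  have r: "fst (row_insert 1 (two i l)) = two (Suc i) (l - 1)"
    "opt_word (snd (row_insert 1 (two i l))) = replicate (min 1 l) 2"
    using row_insert_prefix [of "replicate i 1" 1 "replicate l 2"]
    by (cases l; simp add: replicate_app_Cons_same)+
  show ?case
    using Suc [of "Suc i" "l - 1"] r by (cases l) auto
qed simp

lemma two_eq_iff: "two i l = two i' l' \<longleftrightarrow> i = i' \<and> l = l'"
proof
  assume "two i l = two i' l'"
  then have "filter ((=) k) (two i l) = filter ((=) k) (two i' l')" for k by simp
  from this [of 1] this [of 2] show "i = i' \<and> l = l'"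
    by (simp add: filter_replicate replicate_eq_replicate)
qed simp

lemma sorted_two:
  "sorted r \<Longrightarrow> \<forall>x\<in>set r. 1 \<le> x \<and> x \<le> 2 \<Longrightarrow> \<exists>i l. r = two i l"
proof (induction r)
  case (Cons x r)
  then obtain i l where r: "r = two i l" by auto
  consider "x = 1" | "x = 2" using Cons.prems by force
  then show ?case
  proof cases
    case 1
    then have "x # r = two (Suc i) l" using r by simp
    then show ?thesis by blast
  next
    case 2
    then have "i = 0" using Cons.prems r by (cases i) auto
    then have "x # r = two 0 (Suc l)" using r 2 by simp
    then show ?thesis by blast
  qed
qed simp

lemma below_two: "below (replicate j 2) (two i l) \<Longrightarrow> j \<le> i"
proof (induction j arbitrary: i)
  case (Suc j)
  then show ?case by (cases i; cases l) auto
qed simp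

lemma two_letter_normal_form:
  assumes "set v \<subseteq> {1, 2}"
  obtains r p q where "first_row v = two p q" "rest_word v = replicate r 2" "r \<le> p"
proof -
  have "\<forall>x\<in>set (first_row v) \<union> set (rest_word v). 1 \<le> x \<and> x \<le> 2"
    unfolding set_row_after using assms by auto
  then obtain p q where 1: "first_row v = two p q"
    using sorted_two [OF sorted_first_row [of v]] by auto
  have "\<forall>y\<in>set (rest_word v). y = 2"
  proof
    fix y assume y: "y \<in> set (rest_word v)"
    then obtain x where "x \<in> set v" "x < y" using bumped_greater by blast
    moreover have "y \<le> 2" using set_row_after [of v "[]"] y assms by auto
    ultimately show "y = 2" using assms by auto
  qed
  then have 2: "rest_word v = replicate (length (rest_word v)) 2"
    by (simp add: replicate_length_same)
  \<comment> \<open>Inserted twos bump nothing, so the word of bumped twos is itself the second row,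
    and column strictness bounds its length by the number of ones above.\<close>
  have "first_row (rest_word v) = rest_word v"
    by (subst (1 2) 2) (use two_insert_2 [of "length (rest_word v)" 0 0] in simp)
  then have "below (replicate (length (rest_word v)) 2) (two p q)"
    using below_first_row [of v] 1 2 by metis
  then show ?thesis using that 1 2 below_two by blast
qed

lemma normal_rows:
  assumes "r \<le> p"
  shows "first_row (replicate r 2 @ two p q) = two p q"
    "rest_word (replicate r 2 @ two p q) = replicate r 2"
  using assms two_insert_2 [of r 0 0] two_insert_1 [of p 0 r] two_insert_2 [of q p 0]
  by (auto simp: row_after_append bumped_append min_def)

text \<open>The \<open>r\<close> twos are appended, each of the \<open>p\<close> ones bumps a two as
  long as there is one, and the \<open>q\<close> twos are appended again. The truncated difference
  covers the case of too few twos.\<close>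

lemma rows_append_normal:
  assumes "first_row v = two i l"
  shows "first_row (v @ replicate r 2 @ two p q) = two (i + p) (l + r - p + q)"
    "rest_word (v @ replicate r 2 @ two p q) = rest_word v @ replicate (min p (l + r)) 2"
  using assms two_insert_2 [of r i l] two_insert_1 [of p i "l + r"]
    two_insert_2 [of q "i + p" "l + r - p"]
  by (auto simp: row_after_append bumped_append)

section \<open>When words in normal form commute\<close>

text \<open>The large letters leave \<open>first_row X\<close> at the end of the row; the
  \<open>j\<close> twos, being at least as many, bump all of it; then the ones bump twos. Here
  \<open>v\<close> stands for \<open>u\<close>, or for the empty word to obtain the rows of
  \<open>w\<close> itself.\<close>

lemma large_over_two:
  assumes X: "\<forall>x\<in>set X. 2 < x" and len: "length (first_row X) \<le> j" and ij: "j \<le> i"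
    and v: "first_row v = two p q"
    and w_def: "w = X @ replicate j 2 @ two i l"
  shows "first_row (v @ w) = two (p + i) (q + j - i + l)"
    and "rest_word (v @ w) = rest_word v @ rest_word X @ first_row X @ replicate (min i (q + j)) 2"
proof -
  let ?s = "first_row X"
  have s: "\<forall>x\<in>set ?s. 2 < x" using set_row_after [of X "[]"] X by auto
  have 1: "row_after X (two p q) = two p q @ ?s \<and> bumped X (two p q) = rest_word X"
    using row_after_prefix [of "two p q" X "[]"] X by force
  have 2: "row_after (replicate j 2) (two p q @ ?s) = two p q @ replicate j 2 \<and>
      bumped (replicate j 2) (two p q @ ?s) = ?s"
    by (rule row_after_slide) (use s len in \<open>auto simp: below_replicate\<close>)
  have 3: "two p q @ replicate j 2 = two p (q + j)" by (simp add: replicate_add)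
  note rules = v 1 2 [unfolded 3] two_insert_1 [of i p "q + j"] two_insert_2 [of l "p + i" "q + j - i"]
  show "first_row (v @ w) = two (p + i) (q + j - i + l)"
    "rest_word (v @ w) = rest_word v @ rest_word X @ ?s @ replicate (min i (q + j)) 2"
    unfolding w_def using rules by (auto simp: row_after_append bumped_append simp del: append_assoc)
qed

text \<open>The same process one row lower: \<open>first_row X\<close> pushes out the row of large
  letters left by \<open>rest_word X\<close>, and the twos push out \<open>first_row X\<close>. What
  leaves the row is therefore a reading of \<open>X\<close>.\<close>

lemma large_over_2:
  assumes X: "\<forall>x\<in>set X. 2 < x" and len: "length (first_row X) \<le> c"
    and Y: "Y = replicate r 2 @ rest_word X @ first_row X @ replicate c 2"
  shows "first_row Y = replicate (r + c) 2" and "rest_word Y \<approx> X"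
proof -
  let ?s = "first_row X" and ?t = "first_row (rest_word X)"
  have le: "\<forall>x\<in>set ?s. 2 < x" "\<forall>x\<in>set (rest_word X). 2 < x"
    using set_row_after [of X "[]"] X by auto
  have 0: "first_row (replicate r 2) = replicate r 2 \<and> rest_word (replicate r 2) = []"
    using two_insert_2 [of r 0 0] by simp
  have 1: "row_after (rest_word X) (replicate r 2) = replicate r 2 @ ?t \<and>
      bumped (rest_word X) (replicate r 2) = rest_word (rest_word X)"
    using row_after_prefix [of "replicate r 2" "rest_word X" "[]"] le by force
  have 2: "row_after ?s (replicate r 2 @ ?t) = replicate r 2 @ ?s \<and>
      bumped ?s (replicate r 2 @ ?t) = ?t"
    by (rule row_after_slide) (use le in \<open>auto intro: below_first_row sorted_row_after less_imp_le\<close>)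
  have 3: "row_after (replicate c 2) (replicate r 2 @ ?s) = replicate r 2 @ replicate c 2 \<and>
      bumped (replicate c 2) (replicate r 2 @ ?s) = ?s"
    by (rule row_after_slide) (use le len in \<open>auto simp: below_replicate\<close>)
  show "first_row Y = replicate (r + c) 2"
    unfolding Y using 0 1 2 3 by (auto simp: row_after_append replicate_add)
  have "rest_word Y = rest_word (rest_word X) @ ?t @ ?s"
    unfolding Y using 0 1 2 3 by (auto simp: row_after_append bumped_append)
  also have "\<dots> = (rest_word (rest_word X) @ ?t) @ ?s" by simp
  also have "\<dots> \<approx> rest_word X @ ?s"
    by (intro knuth_append knuth_sym [OF knuth_first_row] knuth_refl)
  also have "\<dots> \<approx> X" by (rule knuth_sym [OF knuth_first_row])
  finally show "rest_word Y \<approx> X" .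
qed

lemma commute_normal_iff:
  assumes X: "\<forall>x\<in>set X. 2 < x" and len: "length (first_row X) \<le> j"
    and ij: "j \<le> i" and rp: "r \<le> p"
    and u_def: "u = replicate r 2 @ two p q" and w_def: "w = X @ replicate j 2 @ two i l"
  shows "u @ w \<approx> w @ u \<longleftrightarrow> min q (i - j) = min l (p - r)"
proof -
  let ?c = "min i (q + j)" and ?d = "min p (l + r)"
  have u: "first_row u = two p q" "rest_word u = replicate r 2"
    unfolding u_def using normal_rows rp by auto
  have uw: "first_row (u @ w) = two (p + i) (q + j - i + l)"
      "rest_word (u @ w) = replicate r 2 @ rest_word X @ first_row X @ replicate ?c 2"
    using large_over_two [OF X len ij u(1) w_def] u(2) by auto
  have w: "first_row w = two i l" "rest_word w = rest_word X @ first_row X @ replicate j 2"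
    using large_over_two [of X j i "[]" 0 0 w l] X len ij w_def by (auto simp: min_def)
  have wu: "first_row (w @ u) = two (i + p) (l + r - p + q)"
      "rest_word (w @ u) = rest_word w @ replicate ?d 2"
    unfolding u_def using rows_append_normal [OF w(1)] by auto
  \<comment> \<open>The empty block of twos brings this word into the form that
    \<open>large_over_2\<close> expects.\<close>
  have wu': "rest_word (w @ u) = replicate 0 2 @ rest_word X @ first_row X @ replicate (j + ?d) 2"
    unfolding wu(2) w(2) by (simp add: replicate_add)
  have lens: "length (first_row X) \<le> ?c" "length (first_row X) \<le> j + ?d" using len ij by auto
  note A = large_over_2 [OF X lens(1) uw(2)] and B = large_over_2 [OF X lens(2) wu']
  have "rest_word (rest_word (u @ w)) \<approx> rest_word (rest_word (w @ u))"
    using A(2) B(2) knuth_sym knuth_trans by blast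
  then have "u @ w \<approx> w @ u \<longleftrightarrow>
      two (p + i) (q + j - i + l) = two (i + p) (l + r - p + q) \<and>
      replicate (r + ?c) (2::nat) = replicate (0 + (j + ?d)) 2"
    unfolding insertion_tableau_eq_iff_knuth [symmetric]
    insertion_tableau_eq_iff [of "u @ w" "w @ u"]
      insertion_tableau_eq_iff [of "rest_word (u @ w)" "rest_word (w @ u)"]
    by (simp only: A(1) B(1) uw(1) wu(1) simp_thms)
  \<comment> \<open>Both row equations reduce to this one, as \<open>?c = j + min q (i - j)\<close>
    and \<open>?d = r + min l (p - r)\<close>, while the first rows keep
    \<open>q - min q (i - j) + l\<close> and \<open>l - min l (p - r) + q\<close> twos.\<close>
  also have "\<dots> \<longleftrightarrow> min q (i - j) = min l (p - r)"
    unfolding two_eq_iff using ij rp by (auto simp: min_def replicate_eq_replicate split: if_splits)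
  finally show ?thesis .
qed

section \<open>Powers of the two-letter word\<close>

lemma normal_append:
  assumes "R \<le> P"
  shows "(replicate R 2 @ two P Q) @ (replicate r 2 @ two p q) \<approx>
    replicate (R + min p (Q + r)) 2 @ two (P + p) (Q + r - p + q)"
  using knuth_first_row [of "(replicate R 2 @ two P Q) @ (replicate r 2 @ two p q)"]
    rows_append_normal [OF normal_rows(1) [OF assms], of Q r p q] normal_rows(2) [OF assms, of Q]
  by (simp add: replicate_add)

text \<open>Since \<open>u\<close> has more twos than ones, the powers of \<open>u\<close> have arbitrarily long second rows.\<close>

lemma commuting_power:
  assumes rp: "r \<le> p" "1 \<le> p" "p < q + r"
    and comm: "(replicate r 2 @ two p q) @ w \<approx> w @ (replicate r 2 @ two p q)"
  shows "\<exists>R P Q. k \<le> R \<and> R \<le> P \<and> p \<le> Q + r \<and>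
    (replicate R 2 @ two P Q) @ w \<approx> w @ (replicate R 2 @ two P Q)"
proof (induction k)
  case 0
  show ?case using assms by (intro exI [of _ r] exI [of _ p] exI [of _ q]) auto
next
  case (Suc k)
  let ?u = "replicate r 2 @ two p q"
  from Suc obtain R P Q where RPQ: "k \<le> R" "R \<le> P" "p \<le> Q + r"
    and U: "(replicate R 2 @ two P Q) @ w \<approx> w @ (replicate R 2 @ two P Q)" by blast
  \<comment> \<open>By the invariant \<open>p <= Q + r\<close>, each of the \<open>p\<close> ones in
    the new factor bumps a two, so the second row grows by \<open>p >= 1\<close>; the invariant
    persists because \<open>p < q + r\<close>.\<close>
  let ?U = "replicate R 2 @ two P Q" and
    ?V = "replicate (R + p) 2 @ two (P + p) (Q + r - p + q)"
  have V: "?U @ ?u \<approx> ?V" using normal_append [of R P Q r p q] RPQ by (simp add: min_def)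
  have "?V @ w \<approx> (?U @ ?u) @ w" by (intro knuth_append knuth_sym [OF V] knuth_refl)
  also have "(?U @ ?u) @ w = ?U @ (?u @ w)" by simp
  also have "\<dots> \<approx> ?U @ (w @ ?u)" by (intro knuth_append comm knuth_refl)
  also have "\<dots> = (?U @ w) @ ?u" by simp
  also have "\<dots> \<approx> (w @ ?U) @ ?u" by (intro knuth_append U knuth_refl)
  also have "\<dots> = w @ (?U @ ?u)" by simp
  also have "\<dots> \<approx> w @ ?V" by (intro knuth_append V knuth_refl)
  finally have "?V @ w \<approx> w @ ?V" .
  then show ?case using RPQ rp
    by (intro exI [of _ "R + p"] exI [of _ "P + p"] exI [of _ "Q + r - p + q"]) auto
qed

section \<open>Appending a long power clears the first two rows of large letters\<close>

lemma insert_many_2: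
  assumes "sorted r" "\<forall>x\<in>set r. 1 \<le> x" "length r \<le> K"
  obtains i l where "row_after (replicate K 2) r = two i (l + K)"
    "length (bumped (replicate K 2) r) \<le> length r"
proof -
  define A where "A = takeWhile (\<lambda>x. x \<le> 2) r"
  define t where "t = dropWhile (\<lambda>x. x \<le> 2) r"
  have r: "r = A @ t" by (simp add: A_def t_def)
  have A: "\<forall>x\<in>set A. 1 \<le> x \<and> x \<le> 2" using assms(2) r unfolding A_def by (auto dest: set_takeWhileD)
  have "\<forall>x\<in>set t. 2 < x"
  proof (cases t)
    case (Cons h t')
    then have "2 < h" using hd_dropWhile [of "\<lambda>x. x \<le> 2" r] unfolding t_def by auto
    moreover have "sorted t" using assms(1) r by (simp add: sorted_append)
    ultimately show ?thesis using Cons by auto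
  qed simp
  then have "below t (replicate K 2)" using assms(3) r by (auto simp: below_replicate)
  from row_after_slide [OF this, of A] A
  have "row_after (replicate K 2) r = A @ replicate K 2 \<and> bumped (replicate K 2) r = t"
    unfolding r by auto
  moreover obtain i l where "A = two i l"
    using sorted_two [OF _ A] assms(1) r by (auto simp: sorted_append)
  ultimately show ?thesis using that [of i l] r by (simp add: replicate_add)
qed

text \<open>The \<open>K\<close> twos clear the first row. The ones then send at least
  \<open>K\<close> twos into the second row, which holds at most \<open>length w\<close> letters by
  then and is cleared too.\<close>

lemma rows_small_after_normal:
  assumes "\<forall>x\<in>set w. 1 \<le> x" "length w \<le> K" "K \<le> P"
    and v: "v = w @ replicate K 2 @ two P B"
  shows "\<forall>x\<in>set (first_row v) \<union> set (first_row (rest_word v)). x \<le> 2"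
proof -
  let ?r = "first_row w" and ?t = "bumped (replicate K 2) (first_row w)"
  have len: "length ?r + length (rest_word w) = length w" using length_row_after [of w "[]"] by simp
  have pos: "\<forall>x\<in>set ?r \<union> set (rest_word w). 1 \<le> x"
    unfolding set_row_after using assms(1) by simp
  then obtain i l where 1: "row_after (replicate K 2) ?r = two i (l + K)" and t: "length ?t \<le> length ?r"
    using insert_many_2 [OF sorted_first_row [of w], of K] len assms(2) by auto
  have "\<forall>x\<in>set (row_after (replicate K 2) ?r) \<union> set ?t. 1 \<le> x"
    unfolding set_row_after using pos by auto
  then have tpos: "\<forall>x\<in>set ?t. 1 \<le> x" by blast
  let ?c = "min P (l + K)"
  have v1: "first_row v = two (i + P) (l + K - P + B)"
    "rest_word v = rest_word w @ ?t @ replicate ?c 2"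
    unfolding v using 1 two_insert_1 [of P i "l + K"] two_insert_2 [of B "i + P" "l + K - P"]
    by (auto simp: row_after_append bumped_append)
  let ?s = "first_row (rest_word w @ ?t)"
  have short: "length ?s \<le> ?c"
    using length_row_after [of "rest_word w @ ?t" "[]"] len t assms by auto
  have "\<forall>x\<in>set ?s \<union> set (rest_word (rest_word w @ ?t)). 1 \<le> x"
    unfolding set_row_after using pos tpos by auto
  then obtain i' l' where "row_after (replicate ?c 2) ?s = two i' (l' + ?c)"
    using insert_many_2 [OF sorted_first_row _ short] by blast
  then have "first_row (rest_word v) = two i' (l' + ?c)"
    unfolding v1 by (simp add: row_after_append)
  then show ?thesis using v1 by (auto split: if_splits)
qed

section \<open>Large letters inserted last remain in the first two rows\<close>

lemma last_in_row_after: "s \<noteq> [] \<Longrightarrow> last s \<in> set (row_after s r)"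
proof -
  have "x \<in> set (fst (row_insert x q))" for x q by (induction q) auto
  then show ?thesis if "s \<noteq> []"
    using that by (cases s rule: rev_cases) (auto simp: row_after_append)
qed

text \<open>Iterates \<open>bump_mono\<close> along an increasing word, to show that such a word
  bumps an increasing word.\<close>

lemma bumped_ge:
  assumes "sorted (x # s)" "sorted r" "y' \<in> set (bumped s (fst (row_insert x r)))"
  shows "\<exists>y. snd (row_insert x r) = Some y \<and> y \<le> y'"
  using assms
proof (induction s arbitrary: x r)
  case (Cons x' s)
  let ?r = "fst (row_insert x r)"
  have "\<exists>y''. snd (row_insert x' ?r) = Some y'' \<and> y'' \<le> y'"
  proof (cases "y' \<in> set (bumped s (fst (row_insert x' ?r)))")
    case True
    then show ?thesis using Cons.IH [of x' ?r] Cons.prems sorted_row_insert by auto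
  next
    case False
    then show ?thesis using Cons.prems by (cases "snd (row_insert x' ?r)") auto
  qed
  then obtain y'' where "snd (row_insert x' ?r) = Some y''" "y'' \<le> y'" by blast
  then show ?case using bump_mono [of x x' r y''] Cons.prems by auto
qed simp

lemma sorted_bumped: "sorted s \<Longrightarrow> sorted r \<Longrightarrow> sorted (bumped s r)"
proof (induction s arbitrary: r)
  case (Cons x s)
  have "sorted (bumped s (fst (row_insert x r)))"
    using Cons by (auto intro: Cons.IH sorted_row_insert)
  then show ?case
    using bumped_ge [OF Cons.prems]
    by (cases "snd (row_insert x r)") (simp_all add: less_imp_le)
qed simp

text \<open>In use, \<open>s\<close> and \<open>t\<close> are rows 1 and 2 of \<open>P(w)\<close>.
  Inserting \<open>s\<close> bumps an increasing word whose last letter stays in the second row, so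
  the bound there covers everything bumped. Hence it holds for \<open>s\<close> and for the row
  before \<open>s\<close>, which contains the last and largest letter of \<open>t\<close>.\<close>

lemma rows_small_of_prefix:
  fixes k :: nat
  assumes "sorted s" "sorted t"
    and v: "v = z @ t @ s"
    and 1: "\<forall>x\<in>set (first_row v). x \<le> k"
    and 2: "\<forall>x\<in>set (first_row (rest_word v)). x \<le> k"
  shows "\<forall>x\<in>set s \<union> set t. x \<le> k"
proof -
  have last_le: "\<forall>x\<in>set q. x \<le> k" if "sorted q" "q \<noteq> [] \<Longrightarrow> last q \<le> k" for q :: "nat list"
    using that by (cases q rule: rev_cases) (auto simp: sorted_append)
  let ?r = "row_after z []" and ?q = "row_after (z @ t) []"
  let ?b = "bumped s ?q"
  have q: "sorted ?q" by (simp add: sorted_row_after)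
  have "\<forall>x\<in>set ?b. x \<le> k"
  proof (rule last_le)
    show "sorted ?b" by (rule sorted_bumped [OF assms(1) q])
    assume "?b \<noteq> []"
    then have "last ?b \<in> set (first_row (rest_word v))"
      unfolding v using last_in_row_after [of ?b] by (simp add: bumped_append row_after_append)
    then show "last ?b \<le> k" using 2 by blast
  qed
  moreover have "first_row v = row_after s ?q" unfolding v by (simp add: row_after_append)
  ultimately have "\<forall>x\<in>set (row_after s ?q) \<union> set ?b. x \<le> k" using 1 by auto
  then have all: "\<forall>x\<in>set s \<union> set ?q. x \<le> k" unfolding set_row_after .
  have "\<forall>x\<in>set t. x \<le> k"
  proof (rule last_le [OF assms(2)])
    assume "t \<noteq> []"
    then have "last t \<in> set ?q" using last_in_row_after [of t ?r] by (simp add: row_after_append)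
    then show "last t \<le> k" using all by blast
  qed
  then show ?thesis using all by blast
qed

section \<open>Singleton columns and rows of the tableau\<close>

lemma row_length_le: "r \<in> set (insertion_tableau w) \<Longrightarrow> length r \<le> length (first_row w)"
proof (induction "length w" arbitrary: w rule: less_induct)
  case less
  then show ?case
  proof (cases "w = []")
    case False
    then show ?thesis
      using less.prems less.hyps [OF length_rest_word_less [OF False]]
        below_length [OF below_first_row [of w]] by (auto simp: insertion_tableau_rec)
  qed simp
qed

text \<open>Here \<open>n\<close> is the greatest length among the lower rows, so exactly the
  columns after the first \<open>n\<close> are singletons. Removing the first column lowers a
  positive \<open>n\<close> by one.\<close>

lemma count_singletons_transpose:
  assumes "\<forall>r\<in>set rs. length r \<le> n" "n \<le> length q" "0 < n \<Longrightarrow> \<exists>r\<in>set rs. length r = n"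
  shows "count_list (transpose (q # rs)) [a] = count_list (drop n q) a"
  using assms
proof (induction q arbitrary: n rs)
  case Nil
  then have "transpose ([] # rs) = []" by (subst transpose_empty) auto
  then show ?case by simp
next
  case (Cons x q)
  let ?hs = "concat (map (case_list [] (\<lambda>h t. [h])) rs)"
  let ?ts = "concat (map (case_list [] (\<lambda>h t. [t])) rs)"
  have tr: "transpose ((x # q) # rs) = (x # ?hs) # transpose (q # ?ts)" by simp
  have ts: "t \<in> set ?ts \<longleftrightarrow> (\<exists>h. h # t \<in> set rs)" for t
    by (force split: list.splits)
  show ?case
  proof (cases n)
    case 0
    then have "\<forall>r\<in>set rs. r = []" using Cons.prems by auto
    then have "?hs = []" by auto
    moreover have "count_list (transpose (q # ?ts)) [a] = count_list (drop 0 q) a"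
      using \<open>\<forall>r\<in>set rs. r = []\<close> by (intro Cons.IH) auto
    ultimately show ?thesis unfolding tr using 0 by simp
  next
    case (Suc m)
    then obtain r where "r \<in> set rs" "length r = Suc m" using Cons.prems by auto
    then obtain h t where ht: "h # t \<in> set rs" "length t = m" by (auto simp: length_Suc_conv)
    then have "?hs \<noteq> []" by force
    moreover have "count_list (transpose (q # ?ts)) [a] = count_list (drop m q) a"
    proof (rule Cons.IH)
      show "\<forall>r\<in>set ?ts. length r \<le> m" using Cons.prems(1) Suc unfolding ts by fastforce
      show "m \<le> length q" using Cons.prems Suc by simp
      show "\<exists>r\<in>set ?ts. length r = m" using ht ts by blast
    qed
    ultimately show ?thesis unfolding tr using Suc by simp
  qed
qed

lemma singleton_columns_eq:
  "singleton_columns a w = count_list (drop (length (first_row (rest_word w))) (first_row w)) a"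
proof (cases "w = []")
  case False
  show ?thesis
    unfolding singleton_columns_def insertion_tableau_rec [OF False]
  proof (rule count_singletons_transpose)
    show "\<forall>r\<in>set (insertion_tableau (rest_word w)). length r \<le> length (first_row (rest_word w))"
      using row_length_le by blast
    show "length (first_row (rest_word w)) \<le> length (first_row w)"
      by (rule below_length [OF below_first_row])
    assume "0 < length (first_row (rest_word w))"
    then have "rest_word w \<noteq> []" by auto
    then show "\<exists>r\<in>set (insertion_tableau (rest_word w)). length r = length (first_row (rest_word w))"
      by (auto simp: insertion_tableau_rec)
  qed
qed (simp add: singleton_columns_def)

text \<open>Absent rows agree as well: they are read as \<open>[]\<close>, which is the first row of
  the empty word.\<close>

lemma tableau_row_eq:
  "tableau_row 1 w = first_row w" "tableau_row 2 w = first_row (rest_word w)"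
proof -
  show "tableau_row 1 w = first_row w"
    by (cases "w = []") (simp_all add: tableau_row_def insertion_tableau_rec)
  show "tableau_row 2 w = first_row (rest_word w)"
    using insertion_tableau_rec [of w] insertion_tableau_rec [of "rest_word w"]
    by (cases "w = []"; cases "rest_word w = []") (auto simp: tableau_row_def)
qed

section \<open>The two directions of the equivalence\<close>

text \<open>Letters bumped once are at least 2, so a second row without larger letters consists of
  twos; letters bumped out of it exceed 2 and form \<open>X\<close>.\<close>

lemma small_rows_normal_form:
  assumes pos: "\<forall>x\<in>set w. 1 \<le> x"
    and small: "\<forall>x\<in>set (first_row w) \<union> set (first_row (rest_word w)). x \<le> 2"
  obtains X j i l where "first_row w = two i l" "first_row (rest_word w) = replicate j 2"
    "\<forall>x\<in>set X. 2 < x" "length (first_row X) \<le> j" "j \<le> i"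
    "w \<approx> X @ replicate j 2 @ two i l"
proof -
  let ?X = "rest_word (rest_word w)"
  have "\<forall>x\<in>set (first_row w) \<union> set (rest_word w). 1 \<le> x"
    unfolding set_row_after using pos by simp
  then obtain i l where 1: "first_row w = two i l"
    using sorted_two [OF sorted_first_row [of w]] small by auto
  have ge2: "\<forall>x\<in>set (rest_word w). 2 \<le> x" using bumped_greater [of _ w] pos by fastforce
  then have "\<forall>x\<in>set (first_row (rest_word w)) \<union> set ?X. 2 \<le> x"
    unfolding set_row_after by simp
  then have "\<forall>x\<in>set (first_row (rest_word w)). x = 2" using small by (simp add: antisym)
  then obtain j where 2: "first_row (rest_word w) = replicate j 2"
    by (metis replicate_length_same)
  have 3: "\<forall>x\<in>set ?X. 2 < x" using bumped_greater [of _ "rest_word w"] ge2 by fastforce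
  have 4: "length (first_row ?X) \<le> j"
    using below_length [OF below_first_row [of "rest_word w"]] 2 by simp
  have 5: "j \<le> i" using below_first_row [of w] 1 2 below_two by simp
  have "w \<approx> rest_word w @ first_row w" by (rule knuth_first_row)
  also have "\<dots> \<approx> (?X @ first_row (rest_word w)) @ first_row w"
    by (intro knuth_append knuth_first_row knuth_refl)
  finally have "w \<approx> ?X @ replicate j 2 @ two i l" using 1 2 by simp
  then show ?thesis using that 1 2 3 4 5 by blast
qed

lemma commuting_rows_small:
  assumes pos: "\<forall>x\<in>set w. 1 \<le> x" and rp: "r \<le> p" "1 \<le> p" "p < q + r"
    and comm: "(replicate r 2 @ two p q) @ w \<approx> w @ (replicate r 2 @ two p q)"
  shows "\<forall>x\<in>set (first_row w) \<union> set (first_row (rest_word w)). x \<le> 2"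
proof -
  obtain R P Q where RP: "length w \<le> R" "R \<le> P"
    and U: "(replicate R 2 @ two P Q) @ w \<approx> w @ (replicate R 2 @ two P Q)"
    using commuting_power [OF rp comm, of "length w"] by blast
  let ?U = "replicate R 2 @ two P Q"
  \<comment> \<open>This spells \<open>w\<close> by its rows, so that rows 2 and 1 come last as
    \<open>rows_small_of_prefix\<close> requires.\<close>
  let ?v = "(?U @ rest_word (rest_word w)) @ first_row (rest_word w) @ first_row w"
  have "?v = ?U @ ((rest_word (rest_word w) @ first_row (rest_word w)) @ first_row w)" by simp
  also have "\<dots> \<approx> ?U @ (rest_word w @ first_row w)"
    by (intro knuth_append knuth_sym [OF knuth_first_row] knuth_refl)
  also have "\<dots> \<approx> ?U @ w" by (intro knuth_append knuth_sym [OF knuth_first_row] knuth_refl)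
  also note U
  finally have "insertion_tableau ?v = insertion_tableau (w @ ?U)" by (rule knuth_insertion_tableau)
  then have rows: "tableau_row k ?v = tableau_row k (w @ ?U)" for k by (simp only: tableau_row_def)
  have "first_row ?v = first_row (w @ ?U)"
    "first_row (rest_word ?v) = first_row (rest_word (w @ ?U))"
    using rows [of 1] rows [of 2] unfolding tableau_row_eq .
  then have "\<forall>x\<in>set (first_row ?v) \<union> set (first_row (rest_word ?v)). x \<le> 2"
    using rows_small_after_normal [OF pos RP refl, of Q] by (simp only:)
  then have "\<forall>x\<in>set (first_row ?v). x \<le> 2" "\<forall>x\<in>set (first_row (rest_word ?v)). x \<le> 2"
    by blast+
  then show ?thesis by (rule rows_small_of_prefix [OF sorted_first_row sorted_first_row refl])
qed

theorem theorem2p8: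
  fixes n :: nat and u w :: "nat list"
  assumes "set u \<subseteq> {1, 2}" and "length u = n"
    and "1 \<le> count_list u 1" and "count_list u 1 < count_list u 2"
    and "w \<in> pos_words"
  shows "w \<in> commuting_words u \<longleftrightarrow>
    (singleton_columns 1 w = singleton_columns 1 u \<and> singleton_columns 1 u \<le> singleton_columns 2 w \<or>
     singleton_columns 1 w = singleton_columns 2 w \<and> singleton_columns 2 w < singleton_columns 1 u) \<and>
    (\<forall>i\<in>{1..2}. tableau_row i w \<noteq> [] \<longrightarrow> Max (set (tableau_row i w)) \<le> 2)"
proof -
  obtain r p q where u: "first_row u = two p q" "rest_word u = replicate r 2" "r \<le> p"
    using two_letter_normal_form [OF assms(1)] by metis
  let ?N = "replicate r 2 @ two p q"
  have uN: "u \<approx> ?N" using knuth_first_row [of u] u by simp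
  \<comment> \<open>Counting letters turns the hypothesis on \<open>u\<close> into
    \<open>1 <= p < q + r\<close>.\<close>
  have "mset u = mset (two p q) + mset (replicate r 2)"
    using mset_row_after [of u "[]"] u by simp
  then have "count (mset u) 1 = p" "count (mset u) 2 = q + r" by (simp_all del: One_nat_def)
  then have rp: "r \<le> p" "1 \<le> p" "p < q + r" using assms u(3) by (simp_all add: count_mset)
  have pos: "\<forall>x\<in>set w. 1 \<le> x" using assms(5) by (auto simp: pos_words_def)
  let ?small = "\<forall>x\<in>set (first_row w) \<union> set (first_row (rest_word w)). x \<le> 2"
  have b: "(\<forall>i\<in>{1..2}. tableau_row i w \<noteq> [] \<longrightarrow> Max (set (tableau_row i w)) \<le> 2) \<longleftrightarrow> ?small"
  proof -
    have "{1..2} = {1, 2::nat}" by auto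
    then show ?thesis using tableau_row_eq [of w] by (auto simp del: One_nat_def)
  qed
  have "w \<in> commuting_words u \<longleftrightarrow> u @ w \<approx> w @ u"
    using assms(5) by (simp add: commuting_words_def insertion_tableau_eq_iff_knuth)
  also have "\<dots> \<longleftrightarrow> ?N @ w \<approx> w @ ?N"
    using knuth_append [OF uN knuth_refl [of w]] knuth_append [OF knuth_refl [of w] uN]
      knuth_sym knuth_trans by blast
  finally have comm: "w \<in> commuting_words u \<longleftrightarrow> ?N @ w \<approx> w @ ?N" .
  show ?thesis
  proof (cases ?small)
    case False
    then show ?thesis using commuting_rows_small [OF pos rp] b comm by blast
  next
    case True
    then obtain X j i l where w: "first_row w = two i l" "first_row (rest_word w) = replicate j 2"
      and X: "\<forall>x\<in>set X. 2 < x" "length (first_row X) \<le> j" "j \<le> i"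
      and wW: "w \<approx> X @ replicate j 2 @ two i l"
      using small_rows_normal_form [OF pos True] by metis
    let ?W = "X @ replicate j 2 @ two i l"
    have "?N @ w \<approx> w @ ?N \<longleftrightarrow> ?N @ ?W \<approx> ?W @ ?N"
      using knuth_append [OF wW knuth_refl [of ?N]] knuth_append [OF knuth_refl [of ?N] wW]
        knuth_sym knuth_trans by blast
    also have "\<dots> \<longleftrightarrow> min q (i - j) = min l (p - r)"
      using commute_normal_iff [OF X rp(1) refl refl] .
    finally have "w \<in> commuting_words u \<longleftrightarrow> min q (i - j) = min l (p - r)" using comm by blast
    moreover have col: "count_list (drop k (two c d)) 1 = c - k" "k \<le> c \<Longrightarrow> count_list (drop k (two c d)) 2 = d"
      for k c d by (simp_all add: count_mset [symmetric] del: One_nat_def)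
    have "first_row (rest_word u) = replicate r 2" using two_insert_2 [of r 0 0] u by simp
    then have "singleton_columns 1 u = p - r" "singleton_columns 1 w = i - j" "singleton_columns 2 w = l"
      unfolding singleton_columns_eq using u w X(3) col by simp_all
    \<comment> \<open>Since \<open>p - r < q\<close>, the equation of minima means
      \<open>i - j = min l (p - r)\<close>; the two alternatives of the theorem are
      \<open>p - r <= l\<close> and \<open>l < p - r\<close>.\<close>
    ultimately show ?thesis using True b rp by (auto simp: min_def)
  qed
qed

end
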